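(* Let $R$ be a commutative Noetherian ring and let $\mathcal{T}$ be an $R$-linear category which has finite direct sums, satisfies the Krull-Remak-Schmidt property and has a small skeleton. Then the Alexandrov space $\mathcal{A}(\mathcal{T})$ is compact if and only if there is a single object $M$ of $\mathcal{T}$ such that $\bigcap_{X \in \mathcal{T}} \mathrm{ann}_R X = \mathrm{ann}_R M$.
   Context: For an object $M$ of an $R$-linear category $\mathcal{T}$ (Hom-sets are $R$-modules and composition is $R$-bilinear), $\mathrm{ann}_R M := \mathrm{ann}_R\,\mathrm{End}_{\mathcal{T}}(M)$ is the annihilator in $R$ of the $R$-module $\mathrm{End}_{\mathcal{T}}(M)$. Define a preorder on the set of isomorphism classes of objects of $\mathcal{T}$ by $N \le M$ if and only if $\mathrm{ann}_R N \subseteq \mathrm{ann}_R M$. Put $\mathrm{cl}(M) = \{N : \mathrm{ann}_R N \subseteq \mathrm{ann}_R M\}$ and $\mathrm{cl}(U) = \bigcup_{M \in U} \mathrm{cl}(M)$ for a set $U$ of isomorphism classes. The Alexandrov space $\mathcal{A}(\mathcal{T})$ is the set of isomorphism classes of objects of $\mathcal{T}$ with the topology in which $U$ is closed if and only if $\mathrm{cl}(U) = U$. Compact means that every open cover has a finite subcover (no separation assumed). *)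

theory Defs
  imports
    "HOL-Algebra.Module"
    "HOL-Algebra.Ring_Divisibility"
    "HOL-Analysis.Abstract_Topology"
begin

section \<open>Linear categories\<close>

text \<open>
  \<open>Comp C X Y Z g f\<close> is the composite of \<open>f : X \<rightarrow> Y\<close> with \<open>g : Y \<rightarrow> Z\<close>. The objects are arguments
  of \<open>Comp\<close> because different Hom-sets are not required to be disjoint. Hom-sets are modules in the
  sense of HOL-Algebra, whose record type extends that of rings; the ring multiplication and unit
  of \<open>Hom C X Y\<close> are never used.
\<close>

record ('o, 'r, 'm) lin_cat =
  Obj :: "'o set"
  Hom :: "'o \<Rightarrow> 'o \<Rightarrow> ('r, 'm) module"
  Comp :: "'o \<Rightarrow> 'o \<Rightarrow> 'o \<Rightarrow> 'm \<Rightarrow> 'm \<Rightarrow> 'm"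
  Ident :: "'o \<Rightarrow> 'm"

locale linear_category = cring R
  for R :: "('r, 'x) ring_scheme" (structure) and C :: "('o, 'r, 'm) lin_cat" +
  assumes hom_module:
      "\<lbrakk>X \<in> Obj C; Y \<in> Obj C\<rbrakk> \<Longrightarrow> Module.module R (Hom C X Y)"
    and ident_closed:
      "X \<in> Obj C \<Longrightarrow> Ident C X \<in> carrier (Hom C X X)"
    and comp_closed:
      "\<lbrakk>X \<in> Obj C; Y \<in> Obj C; Z \<in> Obj C; f \<in> carrier (Hom C X Y); g \<in> carrier (Hom C Y Z)\<rbrakk>
       \<Longrightarrow> Comp C X Y Z g f \<in> carrier (Hom C X Z)"
    and comp_ident_left:
      "\<lbrakk>X \<in> Obj C; Y \<in> Obj C; f \<in> carrier (Hom C X Y)\<rbrakk> \<Longrightarrow> Comp C X Y Y (Ident C Y) f = f"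
    and comp_ident_right:
      "\<lbrakk>X \<in> Obj C; Y \<in> Obj C; f \<in> carrier (Hom C X Y)\<rbrakk> \<Longrightarrow> Comp C X X Y f (Ident C X) = f"
    and comp_assoc:
      "\<lbrakk>W \<in> Obj C; X \<in> Obj C; Y \<in> Obj C; Z \<in> Obj C;
        f \<in> carrier (Hom C W X); g \<in> carrier (Hom C X Y); h \<in> carrier (Hom C Y Z)\<rbrakk>
       \<Longrightarrow> Comp C W Y Z h (Comp C W X Y g f) = Comp C W X Z (Comp C X Y Z h g) f"
    and comp_add_right:
      "\<lbrakk>X \<in> Obj C; Y \<in> Obj C; Z \<in> Obj C;
        f \<in> carrier (Hom C X Y); f' \<in> carrier (Hom C X Y); g \<in> carrier (Hom C Y Z)\<rbrakk>
       \<Longrightarrow> Comp C X Y Z g (f \<oplus>\<^bsub>Hom C X Y\<^esub> f')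
           = Comp C X Y Z g f \<oplus>\<^bsub>Hom C X Z\<^esub> Comp C X Y Z g f'"
    and comp_add_left:
      "\<lbrakk>X \<in> Obj C; Y \<in> Obj C; Z \<in> Obj C;
        f \<in> carrier (Hom C X Y); g \<in> carrier (Hom C Y Z); g' \<in> carrier (Hom C Y Z)\<rbrakk>
       \<Longrightarrow> Comp C X Y Z (g \<oplus>\<^bsub>Hom C Y Z\<^esub> g') f
           = Comp C X Y Z g f \<oplus>\<^bsub>Hom C X Z\<^esub> Comp C X Y Z g' f"
    and comp_smult_right:
      "\<lbrakk>X \<in> Obj C; Y \<in> Obj C; Z \<in> Obj C; r \<in> carrier R;
        f \<in> carrier (Hom C X Y); g \<in> carrier (Hom C Y Z)\<rbrakk>
       \<Longrightarrow> Comp C X Y Z g (r \<odot>\<^bsub>Hom C X Y\<^esub> f) = r \<odot>\<^bsub>Hom C X Z\<^esub> Comp C X Y Z g f"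
    and comp_smult_left:
      "\<lbrakk>X \<in> Obj C; Y \<in> Obj C; Z \<in> Obj C; r \<in> carrier R;
        f \<in> carrier (Hom C X Y); g \<in> carrier (Hom C Y Z)\<rbrakk>
       \<Longrightarrow> Comp C X Y Z (r \<odot>\<^bsub>Hom C Y Z\<^esub> g) f = r \<odot>\<^bsub>Hom C X Z\<^esub> Comp C X Y Z g f"

definition isomorphic :: "('o, 'r, 'm) lin_cat \<Rightarrow> 'o \<Rightarrow> 'o \<Rightarrow> bool" where
  "isomorphic C X Y \<longleftrightarrow>
     (\<exists>f \<in> carrier (Hom C X Y). \<exists>g \<in> carrier (Hom C Y X).
        Comp C X Y X g f = Ident C X \<and> Comp C Y X Y f g = Ident C Y)"

definition iso_rel :: "('o, 'r, 'm) lin_cat \<Rightarrow> ('o \<times> 'o) set" where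
  "iso_rel C = {(X, Y). X \<in> Obj C \<and> Y \<in> Obj C \<and> isomorphic C X Y}"

definition iso_classes :: "('o, 'r, 'm) lin_cat \<Rightarrow> 'o set set" where
  "iso_classes C = Obj C // iso_rel C"

text \<open>
  A skeleton. In HOL the objects already form a set of some type, so this only asks for
  representatives of the isomorphism classes: smallness holds automatically.
\<close>

definition has_small_skeleton :: "('o, 'r, 'm) lin_cat \<Rightarrow> bool" where
  "has_small_skeleton C \<longleftrightarrow> (\<exists>S \<subseteq> Obj C. \<forall>X \<in> Obj C. \<exists>!Y. Y \<in> S \<and> isomorphic C X Y)"

section \<open>Direct sums and the Krull-Remak-Schmidt property\<close>

text \<open>\<open>S\<close> is a biproduct of \<open>X 0, \<dots>, X (n - 1)\<close>; for \<open>n = 0\<close> this says that \<open>S\<close> is a zero object.\<close>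

definition is_direct_sum :: "('o, 'r, 'm) lin_cat \<Rightarrow> nat \<Rightarrow> (nat \<Rightarrow> 'o) \<Rightarrow> 'o \<Rightarrow> bool" where
  "is_direct_sum C n X S \<longleftrightarrow>
     S \<in> Obj C \<and> (\<forall>k<n. X k \<in> Obj C) \<and>
     (\<exists>\<iota> \<pi>. (\<forall>k<n. \<iota> k \<in> carrier (Hom C (X k) S) \<and> \<pi> k \<in> carrier (Hom C S (X k))) \<and>
       (\<forall>k<n. \<forall>l<n. Comp C (X l) S (X k) (\<pi> k) (\<iota> l)
          = (if k = l then Ident C (X k) else \<zero>\<^bsub>Hom C (X l) (X k)\<^esub>)) \<and>
       finsum (Hom C S S) (\<lambda>k. Comp C S (X k) S (\<iota> k) (\<pi> k)) {..<n} = Ident C S)"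

definition has_finite_direct_sums :: "('o, 'r, 'm) lin_cat \<Rightarrow> bool" where
  "has_finite_direct_sums C \<longleftrightarrow>
     (\<forall>n X. (\<forall>k<n. X k \<in> Obj C) \<longrightarrow> (\<exists>S. is_direct_sum C n X S))"

definition is_zero_object :: "('o, 'r, 'm) lin_cat \<Rightarrow> 'o \<Rightarrow> bool" where
  "is_zero_object C Z \<longleftrightarrow> Z \<in> Obj C \<and>
     (\<forall>X \<in> Obj C. (\<exists>!f. f \<in> carrier (Hom C Z X)) \<and> (\<exists>!f. f \<in> carrier (Hom C X Z)))"

definition indecomposable :: "('o, 'r, 'm) lin_cat \<Rightarrow> 'o \<Rightarrow> bool" where
  "indecomposable C X \<longleftrightarrow> X \<in> Obj C \<and> \<not> is_zero_object C X \<and>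
     (\<forall>Y. is_direct_sum C 2 Y X \<longrightarrow> is_zero_object C (Y 0) \<or> is_zero_object C (Y 1))"

text \<open>
  Existence and uniqueness (up to order and isomorphism) of finite decompositions into
  indecomposables. By the Krull-Remak-Schmidt theorem, this is implied by the variant that asks
  for decompositions into objects with local endomorphism rings.
\<close>

definition krull_remak_schmidt :: "('o, 'r, 'm) lin_cat \<Rightarrow> bool" where
  "krull_remak_schmidt C \<longleftrightarrow>
     (\<forall>X \<in> Obj C.
        (\<exists>n Y. (\<forall>k<n. indecomposable C (Y k)) \<and> is_direct_sum C n Y X) \<and>
        (\<forall>n Y m Z.
           (\<forall>k<n. indecomposable C (Y k)) \<and> is_direct_sum C n Y X \<and>
           (\<forall>k<m. indecomposable C (Z k)) \<and> is_direct_sum C m Z X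
           \<longrightarrow> (\<exists>\<sigma>. bij_betw \<sigma> {..<n} {..<m} \<and> (\<forall>k<n. isomorphic C (Y k) (Z (\<sigma> k))))))"

section \<open>Annihilators and the Alexandrov space\<close>

definition annihilator :: "('r, 'x) ring_scheme \<Rightarrow> ('r, 'm, 'y) module_scheme \<Rightarrow> 'r set" where
  "annihilator R M = {r \<in> carrier R. \<forall>x \<in> carrier M. r \<odot>\<^bsub>M\<^esub> x = \<zero>\<^bsub>M\<^esub>}"

definition ann_obj :: "('r, 'x) ring_scheme \<Rightarrow> ('o, 'r, 'm) lin_cat \<Rightarrow> 'o \<Rightarrow> 'r set" where
  "ann_obj R C X = annihilator R (Hom C X X)"

text \<open>
  The common annihilator of the members of an isomorphism class; it is well defined by
  \<open>ann_class_eq\<close> below.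
\<close>

definition ann_class :: "('r, 'x) ring_scheme \<Rightarrow> ('o, 'r, 'm) lin_cat \<Rightarrow> 'o set \<Rightarrow> 'r set" where
  "ann_class R C N = the_elem (ann_obj R C ` N)"

definition cl_point :: "('r, 'x) ring_scheme \<Rightarrow> ('o, 'r, 'm) lin_cat \<Rightarrow> 'o set \<Rightarrow> 'o set set" where
  "cl_point R C M = {N \<in> iso_classes C. ann_class R C N \<subseteq> ann_class R C M}"

definition cl_set :: "('r, 'x) ring_scheme \<Rightarrow> ('o, 'r, 'm) lin_cat \<Rightarrow> 'o set set \<Rightarrow> 'o set set" where
  "cl_set R C U = (\<Union>M\<in>U. cl_point R C M)"

text \<open>
  The type of topologies is given by its open sets, hence the complement;
  see \<open>closedin_alexandrov_space\<close> below for the closed sets.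
\<close>

definition alexandrov_space ::
    "('r, 'x) ring_scheme \<Rightarrow> ('o, 'r, 'm) lin_cat \<Rightarrow> 'o set topology" where
  "alexandrov_space R C = topology (\<lambda>U. U \<subseteq> iso_classes C \<and>
     cl_set R C (iso_classes C - U) = iso_classes C - U)"

lemma cl_set_complement_iff:
  "cl_set R C (iso_classes C - U) = iso_classes C - U \<longleftrightarrow>
    (\<forall>M \<in> iso_classes C. \<forall>N \<in> iso_classes C.
       ann_class R C N \<subseteq> ann_class R C M \<longrightarrow> N \<in> U \<longrightarrow> M \<in> U)"
  unfolding cl_set_def cl_point_def by blast

lemma istopology_alexandrov_space:
  "istopology (\<lambda>U. U \<subseteq> iso_classes C \<and> cl_set R C (iso_classes C - U) = iso_classes C - U)"
  unfolding istopology_def cl_set_complement_iff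
proof (intro conjI allI impI)
  fix S T :: "'a set set"
  let ?P = "\<lambda>U. U \<subseteq> iso_classes C \<and> (\<forall>M \<in> iso_classes C. \<forall>N \<in> iso_classes C.
       ann_class R C N \<subseteq> ann_class R C M \<longrightarrow> N \<in> U \<longrightarrow> M \<in> U)"
  assume S: "?P S" and T: "?P T"
  show "S \<inter> T \<subseteq> iso_classes C" using S by blast
  show "\<forall>M \<in> iso_classes C. \<forall>N \<in> iso_classes C.
       ann_class R C N \<subseteq> ann_class R C M \<longrightarrow> N \<in> S \<inter> T \<longrightarrow> M \<in> S \<inter> T"
    using S T by (meson IntD1 IntD2 IntI)
next
  fix K :: "'a set set set"
  let ?P = "\<lambda>U. U \<subseteq> iso_classes C \<and> (\<forall>M \<in> iso_classes C. \<forall>N \<in> iso_classes C.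
       ann_class R C N \<subseteq> ann_class R C M \<longrightarrow> N \<in> U \<longrightarrow> M \<in> U)"
  assume K: "\<forall>U\<in>K. ?P U"
  show "\<Union>K \<subseteq> iso_classes C" using K by blast
  show "\<forall>M \<in> iso_classes C. \<forall>N \<in> iso_classes C.
       ann_class R C N \<subseteq> ann_class R C M \<longrightarrow> N \<in> \<Union>K \<longrightarrow> M \<in> \<Union>K"
    using K by (meson UnionE UnionI)
qed

lemma openin_alexandrov_space:
  "openin (alexandrov_space R C) U \<longleftrightarrow>
     U \<subseteq> iso_classes C \<and> cl_set R C (iso_classes C - U) = iso_classes C - U"
  unfolding alexandrov_space_def by (simp add: topology_inverse'[OF istopology_alexandrov_space])

lemma topspace_alexandrov_space: "topspace (alexandrov_space R C) = iso_classes C"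
proof
  show "topspace (alexandrov_space R C) \<subseteq> iso_classes C"
    by (auto simp: topspace_def openin_alexandrov_space)
  have "openin (alexandrov_space R C) (iso_classes C)"
    by (simp add: openin_alexandrov_space cl_set_def)
  then show "iso_classes C \<subseteq> topspace (alexandrov_space R C)"
    by (rule openin_subset)
qed

lemma closedin_alexandrov_space:
  "closedin (alexandrov_space R C) U \<longleftrightarrow> U \<subseteq> iso_classes C \<and> cl_set R C U = U"
  by (auto simp: closedin_def topspace_alexandrov_space openin_alexandrov_space double_diff)

context linear_category
begin

lemma isomorphic_refl:
  assumes "X \<in> Obj C"
  shows "isomorphic C X X"
  unfolding isomorphic_def
  using assms ident_closed comp_ident_left by blast

lemma isomorphic_sym: "isomorphic C X Y \<Longrightarrow> isomorphic C Y X"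
  unfolding isomorphic_def by blast

lemma ann_obj_mono_iso:
  assumes X: "X \<in> Obj C" and Y: "Y \<in> Obj C" and iso: "isomorphic C X Y"
  shows "ann_obj R C X \<subseteq> ann_obj R C Y"
proof
  fix r assume r: "r \<in> ann_obj R C X"
  then have rR: "r \<in> carrier R"
    and ann: "\<And>x. x \<in> carrier (Hom C X X) \<Longrightarrow> r \<odot>\<^bsub>Hom C X X\<^esub> x = \<zero>\<^bsub>Hom C X X\<^esub>"
    by (auto simp: ann_obj_def annihilator_def)
  obtain f g where f: "f \<in> carrier (Hom C X Y)" and g: "g \<in> carrier (Hom C Y X)"
    and fg: "Comp C Y X Y f g = Ident C Y"
    using iso unfolding isomorphic_def by blast
  interpret XX: Module.module R "Hom C X X" using X by (simp add: hom_module)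
  interpret YX: Module.module R "Hom C Y X" using X Y by (simp add: hom_module)
  interpret YY: Module.module R "Hom C Y Y" using Y by (simp add: hom_module)
  have zero_r: "Comp C Y X X \<zero>\<^bsub>Hom C X X\<^esub> k = \<zero>\<^bsub>Hom C Y X\<^esub>" if "k \<in> carrier (Hom C Y X)" for k
    using comp_smult_left[OF Y X X zero_closed that XX.M.zero_closed]
      comp_closed[OF Y X X that XX.M.zero_closed] by simp
  have zero_l: "Comp C Y X Y f \<zero>\<^bsub>Hom C Y X\<^esub> = \<zero>\<^bsub>Hom C Y Y\<^esub>"
    using comp_smult_right[OF Y X Y zero_closed YX.M.zero_closed f]
      comp_closed[OF Y X Y YX.M.zero_closed f] by simp
  have "r \<odot>\<^bsub>Hom C Y Y\<^esub> h = \<zero>\<^bsub>Hom C Y Y\<^esub>" if h: "h \<in> carrier (Hom C Y Y)" for h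
  proof -
    define u where "u = Comp C Y Y X g h"
    have u: "u \<in> carrier (Hom C Y X)" unfolding u_def by (rule comp_closed[OF Y Y X h g])
    have h_eq: "h = Comp C Y X Y f u"
      unfolding u_def using comp_assoc[OF Y Y X Y h g f] fg comp_ident_left[OF Y Y h] by simp
    have "r \<odot>\<^bsub>Hom C Y X\<^esub> u = r \<odot>\<^bsub>Hom C Y X\<^esub> Comp C Y X X (Ident C X) u"
      by (simp add: comp_ident_left[OF Y X u])
    also have "\<dots> = Comp C Y X X (r \<odot>\<^bsub>Hom C X X\<^esub> Ident C X) u"
      by (rule comp_smult_left[OF Y X X rR u ident_closed[OF X], symmetric])
    also have "\<dots> = \<zero>\<^bsub>Hom C Y X\<^esub>"
      by (simp add: ann ident_closed[OF X] zero_r u)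
    finally have "r \<odot>\<^bsub>Hom C Y X\<^esub> u = \<zero>\<^bsub>Hom C Y X\<^esub>" .
    then show ?thesis
      using comp_smult_right[OF Y X Y rR u f] h_eq zero_l by simp
  qed
  then show "r \<in> ann_obj R C Y"
    using rR by (simp add: ann_obj_def annihilator_def)
qed

lemma ann_class_eq:
  assumes "X \<in> Obj C"
  shows "ann_class R C (iso_rel C `` {X}) = ann_obj R C X"
proof -
  have "ann_obj R C Y = ann_obj R C X" if "Y \<in> iso_rel C `` {X}" for Y
    using that ann_obj_mono_iso isomorphic_sym by (fastforce simp: iso_rel_def)
  moreover have "X \<in> iso_rel C `` {X}"
    using assms isomorphic_refl by (simp add: iso_rel_def)
  ultimately have "ann_obj R C ` (iso_rel C `` {X}) = {ann_obj R C X}"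
    by blast
  then show ?thesis
    by (simp add: ann_class_def)
qed

end

end

(* The smallest open neighbourhood of a class [N] is {[X]. ann N <= ann X}, so the space is compact
   iff finitely many objects N_1, ..., N_k satisfy: every ann X contains some ann N_i. Each N_i is
   a retract of the direct sum S of the N_i, hence ann S <= ann N_i, and S alone suffices. *)

theory Submission
  imports Defs
begin

text \<open>Closed sets are stable under passing to smaller annihilators, so their complements are
  the sets stable under passing to larger ones.\<close>

lemma openin_alexandrov_space_iff:
  "openin (alexandrov_space R C) U \<longleftrightarrow> U \<subseteq> iso_classes C \<and>
    (\<forall>N \<in> U. \<forall>M \<in> iso_classes C. ann_class R C N \<subseteq> ann_class R C M \<longrightarrow> M \<in> U)"
  unfolding openin_alexandrov_space cl_set_complement_iff by blast

context linear_category
begin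

lemma comp_zero_left:
  assumes "X \<in> Obj C" "Y \<in> Obj C" "Z \<in> Obj C" "f \<in> carrier (Hom C X Y)"
  shows "Comp C X Y Z \<zero>\<^bsub>Hom C Y Z\<^esub> f = \<zero>\<^bsub>Hom C X Z\<^esub>"
proof -
  interpret YZ: Module.module R "Hom C Y Z" using assms by (simp add: hom_module)
  interpret XZ: Module.module R "Hom C X Z" using assms by (simp add: hom_module)
  show ?thesis
    \<comment> \<open>The zero morphism is the scalar \<open>\<zero>\<close> times itself, and this
      scalar can be pulled out of the composite.\<close>
    using comp_smult_left[OF assms(1-3) zero_closed assms(4) YZ.M.zero_closed]
      comp_closed[OF assms YZ.M.zero_closed] by simp
qed

lemma comp_zero_right:
  assumes "X \<in> Obj C" "Y \<in> Obj C" "Z \<in> Obj C" "g \<in> carrier (Hom C Y Z)"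
  shows "Comp C X Y Z g \<zero>\<^bsub>Hom C X Y\<^esub> = \<zero>\<^bsub>Hom C X Z\<^esub>"
proof -
  interpret XY: Module.module R "Hom C X Y" using assms by (simp add: hom_module)
  interpret XZ: Module.module R "Hom C X Z" using assms by (simp add: hom_module)
  show ?thesis
    using comp_smult_right[OF assms(1-3) zero_closed XY.M.zero_closed assms(4)]
      comp_closed[OF assms(1-3) XY.M.zero_closed assms(4)] by simp
qed

text \<open>By linearity, r h = r (id h) = (r id) h for every endomorphism h, so it is enough to
  test r on the identity.\<close>

lemma mem_ann_obj_iff:
  assumes X: "X \<in> Obj C"
  shows "r \<in> ann_obj R C X \<longleftrightarrow>
    r \<in> carrier R \<and> r \<odot>\<^bsub>Hom C X X\<^esub> Ident C X = \<zero>\<^bsub>Hom C X X\<^esub>"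
proof -
  have "r \<odot>\<^bsub>Hom C X X\<^esub> h = \<zero>\<^bsub>Hom C X X\<^esub>"
    if "r \<in> carrier R" "r \<odot>\<^bsub>Hom C X X\<^esub> Ident C X = \<zero>\<^bsub>Hom C X X\<^esub>" "h \<in> carrier (Hom C X X)" for h
    using comp_smult_left[OF X X X that(1,3) ident_closed[OF X]] that
    by (simp add: X comp_ident_left comp_zero_left)
  then show ?thesis
    using ident_closed[OF X] by (auto simp: ann_obj_def annihilator_def)
qed

text \<open>If r kills the identity of \<open>S\<close>, then r i = (r id) i = 0, and hence r id = r
  (p i) = p (r i) = 0 on \<open>X\<close>.\<close>

lemma ann_obj_retract:
  assumes S: "S \<in> Obj C" and X: "X \<in> Obj C"
    and i: "i \<in> carrier (Hom C X S)" and p: "p \<in> carrier (Hom C S X)"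
    and pi: "Comp C X S X p i = Ident C X"
  shows "ann_obj R C S \<subseteq> ann_obj R C X"
proof
  fix r assume "r \<in> ann_obj R C S"
  then have r: "r \<in> carrier R" and r0: "r \<odot>\<^bsub>Hom C S S\<^esub> Ident C S = \<zero>\<^bsub>Hom C S S\<^esub>"
    using S by (auto simp: mem_ann_obj_iff)
  have "r \<odot>\<^bsub>Hom C X S\<^esub> i = \<zero>\<^bsub>Hom C X S\<^esub>"
    using comp_smult_left[OF X S S r i ident_closed[OF S]] r0
    by (simp add: X S i comp_ident_left comp_zero_left)
  then have "r \<odot>\<^bsub>Hom C X X\<^esub> Ident C X = \<zero>\<^bsub>Hom C X X\<^esub>"
    using comp_smult_right[OF X S X r i p] by (simp add: X S p pi comp_zero_right)
  with r show "r \<in> ann_obj R C X" using X by (simp add: mem_ann_obj_iff)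
qed

lemma ann_obj_direct_sum:
  assumes "is_direct_sum C n X S" and "k < n"
  shows "ann_obj R C S \<subseteq> ann_obj R C (X k)"
proof -
  obtain \<iota> \<pi> where "\<iota> k \<in> carrier (Hom C (X k) S)" "\<pi> k \<in> carrier (Hom C S (X k))"
    "Comp C (X k) S (X k) (\<pi> k) (\<iota> k) = Ident C (X k)"
    \<comment> \<open>The case \<open>k = l\<close> of the biproduct identities.\<close>
    using assms unfolding is_direct_sum_def by force
  moreover have "S \<in> Obj C" "X k \<in> Obj C" using assms by (simp_all add: is_direct_sum_def)
  ultimately show ?thesis by (intro ann_obj_retract)
qed

lemma iso_class_in_iso_classes: "X \<in> Obj C \<Longrightarrow> iso_rel C `` {X} \<in> iso_classes C"
  by (simp add: iso_classes_def quotientI)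

text \<open>Translates compactness into a condition on annihilators of objects, free of topology and
  of isomorphism classes.\<close>

lemma compact_space_alexandrov_space_iff:
  "compact_space (alexandrov_space R C) \<longleftrightarrow>
    (\<exists>F. finite F \<and> F \<subseteq> Obj C \<and> (\<forall>X \<in> Obj C. \<exists>N \<in> F. ann_obj R C N \<subseteq> ann_obj R C X))"
proof
  \<comment> \<open>For an object \<open>N\<close>, this is the smallest open set containing the
    class of \<open>N\<close>. A finite subcover of the cover by all these sets yields
    \<open>F\<close>.\<close>
  define V where "V N = {M \<in> iso_classes C. ann_obj R C N \<subseteq> ann_class R C M}" for N
  assume compact: "compact_space (alexandrov_space R C)"
  have "\<forall>U \<in> V ` Obj C. openin (alexandrov_space R C) U"
    unfolding openin_alexandrov_space_iff V_def by blast
  moreover have "iso_classes C \<subseteq> \<Union>(V ` Obj C)"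
  proof
    fix M assume M: "M \<in> iso_classes C"
    then obtain X where "X \<in> Obj C" "M = iso_rel C `` {X}"
      by (auto simp: iso_classes_def elim: quotientE)
    with M have "X \<in> Obj C" "M \<in> V X" by (auto simp: V_def ann_class_eq)
    then show "M \<in> \<Union>(V ` Obj C)" by blast
  qed
  ultimately obtain \<F> where "finite \<F>" "\<F> \<subseteq> V ` Obj C" and cover: "iso_classes C \<subseteq> \<Union>\<F>"
    using compact[unfolded compact_space_alt topspace_alexandrov_space, rule_format, of "V ` Obj C"]
    by blast
  then obtain F where F: "finite F" "F \<subseteq> Obj C" "\<F> = V ` F"
    by (meson finite_subset_image)
  have "\<exists>N \<in> F. ann_obj R C N \<subseteq> ann_obj R C X" if "X \<in> Obj C" for X
    using subsetD[OF cover iso_class_in_iso_classes[OF that]]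
    by (auto simp: F(3) V_def ann_class_eq[OF that])
  with F show "\<exists>F. finite F \<and> F \<subseteq> Obj C \<and>
      (\<forall>X \<in> Obj C. \<exists>N \<in> F. ann_obj R C N \<subseteq> ann_obj R C X)"
    by blast
next
  assume "\<exists>F. finite F \<and> F \<subseteq> Obj C \<and> (\<forall>X \<in> Obj C. \<exists>N \<in> F. ann_obj R C N \<subseteq> ann_obj R C X)"
  then obtain F where F: "finite F" "F \<subseteq> Obj C"
    and ann: "\<And>X. X \<in> Obj C \<Longrightarrow> \<exists>N \<in> F. ann_obj R C N \<subseteq> ann_obj R C X"
    by blast
  show "compact_space (alexandrov_space R C)"
    unfolding compact_space_alt topspace_alexandrov_space
  proof (intro allI impI, elim conjE)
    fix \<U>
    assume op: "\<forall>U \<in> \<U>. openin (alexandrov_space R C) U" and cover: "iso_classes C \<subseteq> \<Union>\<U>"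
    have "\<forall>N \<in> F. \<exists>U \<in> \<U>. iso_rel C `` {N} \<in> U"
      using cover F(2) iso_class_in_iso_classes by blast
    then obtain u where u: "\<And>N. N \<in> F \<Longrightarrow> u N \<in> \<U> \<and> iso_rel C `` {N} \<in> u N"
      by metis
    \<comment> \<open>One member of the cover for each \<open>N\<close> in \<open>F\<close> is
      enough: being open, \<open>u N\<close> contains with the class of \<open>N\<close> every class
      of larger annihilator.\<close>
    have "iso_classes C \<subseteq> \<Union>(u ` F)"
    proof
      fix M assume M: "M \<in> iso_classes C"
      then obtain X where X: "X \<in> Obj C" "M = iso_rel C `` {X}"
        by (auto simp: iso_classes_def elim: quotientE)
      then obtain N where N: "N \<in> F" "ann_obj R C N \<subseteq> ann_obj R C X" using ann by blast
      then have "ann_class R C (iso_rel C `` {N}) \<subseteq> ann_class R C M"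
        using ann_class_eq[OF X(1)] ann_class_eq[OF subsetD[OF F(2) N(1)]] X(2) by simp
      moreover have "openin (alexandrov_space R C) (u N)" "iso_rel C `` {N} \<in> u N"
        using op u[OF N(1)] by auto
      ultimately have "M \<in> u N"
        using M unfolding openin_alexandrov_space_iff by blast
      with N(1) show "M \<in> \<Union>(u ` F)" by blast
    qed
    then show "\<exists>\<F>. finite \<F> \<and> \<F> \<subseteq> \<U> \<and> iso_classes C \<subseteq> \<Union>\<F>"
      using F(1) u by (intro exI[of _ "u ` F"] conjI) auto
  qed
qed

end

theorem theorem2p6:
  fixes R :: "('r, 'x) ring_scheme" and C :: "('o, 'r, 'm) lin_cat"
  assumes "cring R" and "noetherian_ring R"
    and "linear_category R C"
    and "has_finite_direct_sums C"
    and "krull_remak_schmidt C"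
    and "has_small_skeleton C"
  shows "compact_space (alexandrov_space R C) \<longleftrightarrow>
    (\<exists>M \<in> Obj C. (\<Inter>X \<in> Obj C. ann_obj R C X) = ann_obj R C M)"
proof -
  interpret linear_category R C by fact
  show ?thesis
  proof
    assume "compact_space (alexandrov_space R C)"
    then obtain F where F: "finite F" "F \<subseteq> Obj C"
      and ann: "\<And>X. X \<in> Obj C \<Longrightarrow> \<exists>N \<in> F. ann_obj R C N \<subseteq> ann_obj R C X"
      unfolding compact_space_alexandrov_space_iff by blast
    \<comment> \<open>\<open>F\<close> is enumerated because \<open>is_direct_sum\<close> takes
      families indexed by the naturals below \<open>n\<close>.\<close>
    obtain n and N :: "nat \<Rightarrow> 'o" where N: "F = N ` {i. i < n}"
      using F(1) by (metis finite_imp_nat_seg_image_inj_on)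
    then obtain S where S: "is_direct_sum C n N S"
      using assms(4) F(2) unfolding has_finite_direct_sums_def by blast
    \<comment> \<open>Passes through a summand \<open>N k\<close> whose annihilator lies in that of
      \<open>X\<close>. Thus the annihilator of \<open>S\<close> is the least one and equals the
      intersection.\<close>
    have "ann_obj R C S \<subseteq> ann_obj R C X" if "X \<in> Obj C" for X
      using ann[OF that] ann_obj_direct_sum[OF S] N by blast
    moreover have "S \<in> Obj C" using S by (simp add: is_direct_sum_def)
    ultimately show "\<exists>M \<in> Obj C. (\<Inter>X \<in> Obj C. ann_obj R C X) = ann_obj R C M"
      by blast
  next
    assume "\<exists>M \<in> Obj C. (\<Inter>X \<in> Obj C. ann_obj R C X) = ann_obj R C M"
    then obtain M where "M \<in> Obj C" "\<And>X. X \<in> Obj C \<Longrightarrow> ann_obj R C M \<subseteq> ann_obj R C X"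
      by blast
    then show "compact_space (alexandrov_space R C)"
      \<comment> \<open>A singleton suffices: the only open set containing the class of
        \<open>M\<close> is the whole space.\<close>
      unfolding compact_space_alexandrov_space_iff by (intro exI[of _ "{M}"]) auto
  qed
qed

end
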